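(* Let $n>1$ be an odd integer, let $m$ be a positive odd multiple of $n$, and let $c_{2j}(m)$ ($j\ge 1$) be the coefficients of the power series $P_m(x)=\sum_{j=1}^{\infty}c_{2j}(m)x^{2j}$ defined in the context. Then: (1) For all $j\ge1$, $$c_{2j}(m)=(-1)^{(m+1)/2}\,\frac{\pi}{2^{2j}}\,\left|\binom{1/2}{j}\right|\left[\binom{2j}{(2j-m+1)/2}-\binom{2j}{(2j-m-1)/2}\right].$$ (2) All nonzero coefficients $c_{2j}(m)$, $j\ge 1$, have the same sign, namely $(-1)^{(m+1)/2}$. (3) The leading coefficient (the nonzero coefficient of lowest degree) of $P_m(x)$ is $$c_{m-1}(m)=(-1)^{(m+1)/2}\,\frac{\pi}{2^{m-1}}\left|\binom{1/2}{(m-1)/2}\right|.$$ (4) For all such $m$ and all $j\ge 1$, $$|c_{2j}(m)|\le |c_2(3)|=\frac{\pi}{8}.$$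
   Context: For an odd integer $m>1$ and an integer $j\ge1$, $$c_{2j}(m)=(-1)^j\binom{1/2}{j}\int_0^{2\pi}\cos\theta\,\cos m\theta\,\sin^{2j}\theta\,d\theta ,\qquad P_m(x)=\sum_{j=1}^\infty c_{2j}(m)x^{2j}.$$ In particular $c_2(3)$ is given by this formula with $m=3$, $j=1$. Binomial coefficients: for $r$ a positive integer or $r=1/2$ and $s$ an integer, $\binom{r}{s}$ is the usual (generalized) binomial coefficient, equal to $\frac{r(r-1)\cdots(r-s+1)}{s!}$ for $s\ge 0$, and it is $0$ if $s<0$, or if $r$ is an integer and $s>r$. *)

theory Defs
  imports "HOL-Analysis.Analysis" "HOL-Computational_Algebra.Formal_Power_Series"
begin

text \<open>\<open>c_coeff j m\<close> is $c_{2j}(m)$: the first argument is half the subscript.\<close>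

definition c_coeff :: "nat \<Rightarrow> nat \<Rightarrow> real" where
  "c_coeff j m = (-1) ^ j * ((1/2) gchoose j) *
     integral {0..2 * pi} (\<lambda>\<theta>. cos \<theta> * cos (real m * \<theta>) * sin \<theta> ^ (2 * j))"

text \<open>The formal power series $P_m(x) = \sum_{j \ge 1} c_{2j}(m) x^{2j}$.\<close>

definition P_series :: "nat \<Rightarrow> real fps" where
  "P_series m = Abs_fps (\<lambda>k. if even k \<and> k \<ge> 2 then c_coeff (k div 2) m else 0)"

text \<open>Binomial coefficient with an integer lower entry, zero when that entry is negative.\<close>

definition binom_int :: "nat \<Rightarrow> int \<Rightarrow> nat" where
  "binom_int r s = (if s < 0 then 0 else r choose nat s)"

end

theory Submission
  imports Defs
begin

text \<open>
  Since $\cos\theta\cos((2k+1)\theta) = \frac12(\cos 2k\theta + \cos 2(k+1)\theta)$, everything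
  reduces to the Fourier coefficients of $\sin^{2j}\theta$. Multiplication by
  $\sin^2\theta = \frac12(1-\cos 2\theta)$ acts on them as a signed form of Pascal's rule applied
  twice, so they are signed binomial coefficients. The sign is then the unimodality of a row of
  Pascal's triangle, and the bound follows from $|\binom{1/2}{j}| \le \frac12$ and
  $4\binom{2j}{s} \le 4^j$ for $s < j$.
\<close>

text \<open>Extending the row by zero makes Pascal's rule valid at every integer \<open>s\<close>,
  so the induction over Fourier coefficients below meets no boundary cases.\<close>

lemma binom_int_Suc: "binom_int (Suc r) s = binom_int r s + binom_int r (s - 1)"
proof -
  consider "s < 0" | "s = 0" | t where "s = int (Suc t)"
    by (metis int_cases negative_zless not0_implies_Suc of_nat_0)
  then show ?thesis
  proof cases
    case 3
    then have "nat s = Suc t" "nat (s - 1) = t" "\<not> s < 0" "\<not> s - 1 < 0"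
      by linarith+
    then show ?thesis
      by (simp add: binom_int_def)
  qed (simp_all add: binom_int_def)
qed

lemma binom_int_Suc_Suc:
  "binom_int (Suc (Suc r)) s = binom_int r s + 2 * binom_int r (s - 1) + binom_int r (s - 2)"
  by (simp add: binom_int_Suc)

lemma binom_int_mono:
  assumes "s \<le> t" and "2 * t \<le> int r"
  shows "binom_int r s \<le> binom_int r t"
  using assms by (auto simp: binom_int_def intro!: binomial_mono)

text \<open>Off the centre, Pascal's rule and the symmetry of the row above make
  \<open>2 * (N choose s)\<close> a sum of four different entries of row \<open>N - 1\<close>, hence
  at most \<open>2 ^ (N - 1)\<close>. For \<open>s = 0\<close> one of the four is missing, so that
  case is direct.\<close>

lemma binomial_quarter_bound:
  assumes "2 * s + 1 < N"
  shows "4 * (N choose s) \<le> 2 ^ N"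
proof -
  obtain M where N: "N = Suc M"
    using assms by (cases N) auto
  show ?thesis
  proof (cases s)
    case 0
    then have "2 \<le> N" using assms by simp
    then have "(2::nat) ^ 2 \<le> 2 ^ N" by (intro power_increasing) auto
    then show ?thesis using 0 by simp
  next
    case (Suc t)
    \<comment> \<open>Here \<open>t < Suc t < M - Suc t < M - t\<close>: the hypothesis keeps the
      two entries and their mirror images apart, so the sum over the set really has four
      terms.\<close>
    have "t \<notin> {Suc t, M - Suc t, M - t}" "Suc t \<notin> {M - Suc t, M - t}" "M - Suc t \<noteq> M - t"
      using assms by (auto simp: Suc N)
    then have "2 * (N choose s) = (\<Sum>i\<in>{t, Suc t, M - Suc t, M - t}. M choose i)"
      using assms binomial_symmetric[of t M] binomial_symmetric[of "Suc t" M] by (simp add: Suc N)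
    also have "\<dots> \<le> (\<Sum>i\<le>M. M choose i)"
      using assms by (intro sum_mono2) (auto simp: Suc N)
    also have "\<dots> = 2 ^ M"
      by (rule choose_row_sum)
    finally show ?thesis by (simp add: N)
  qed
qed

lemma has_integral_cos_int_mult:
  "((\<lambda>x. cos (of_int k * x)) has_integral (if k = 0 then 2 * pi else 0)) {0..2 * pi}"
proof (cases "k = 0")
  case True
  then show ?thesis
    using has_integral_const_real[of "1::real" 0 "2 * pi"] by simp
next
  case False
  have "((\<lambda>x. cos (of_int k * x)) has_integral
      (sin (of_int k * (2 * pi)) / of_int k - sin (of_int k * 0) / of_int k)) {0..2 * pi}"
    using False
    by (intro fundamental_theorem_of_calculus)
       (auto intro!: derivative_eq_intros simp flip: has_real_derivative_iff_has_vector_derivative)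
  moreover have "sin (of_int k * (2 * pi)) = 0"
    using sin_int_2pin[of k] by (simp add: mult_ac)
  ultimately show ?thesis
    using False by simp
qed

lemma cos_mult_sin_squared:
  "cos (of_int (2 * k) * x) * (sin x)\<^sup>2 =
     cos (of_int (2 * k) * x) / 2 - cos (of_int (2 * (k + 1)) * x) / 4
       - cos (of_int (2 * (k - 1)) * x) / 4"
  for x :: real
proof -
  have "of_int (2 * (k + 1)) * x = of_int (2 * k) * x + 2 * x"
    "of_int (2 * (k - 1)) * x = of_int (2 * k) * x - 2 * x"
    by (simp_all add: algebra_simps)
  then have "cos (of_int (2 * (k + 1)) * x) + cos (of_int (2 * (k - 1)) * x)
      = 2 * cos (of_int (2 * k) * x) * cos (2 * x)"
    by (simp only: cos_add cos_diff)
  also have "cos (2 * x) = 1 - 2 * (sin x)\<^sup>2"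
    by (simp add: cos_double cos_squared_eq)
  finally show ?thesis
    by (simp add: field_simps)
qed

text \<open>The induction on \<open>j\<close> passes from \<open>k\<close> to its neighbours
  \<open>k - 1\<close> and \<open>k + 1\<close>, so \<open>k\<close> is kept arbitrary and ranges
  over all integers.\<close>

lemma has_integral_cos_mult_sin_power:
  "((\<lambda>x. cos (of_int (2 * k) * x) * sin x ^ (2 * j)) has_integral
     2 * pi * (-1) powi k * real (binom_int (2 * j) (int j - k)) / 4 ^ j) {0..2 * pi}"
proof (induction j arbitrary: k)
  case 0
  show ?case
    using has_integral_cos_int_mult[of "2 * k"] by (cases "k = 0") (auto simp: binom_int_def binomial_eq_0)
next
  case (Suc j)
  let ?I = "\<lambda>k. 2 * pi * (-1) powi k * real (binom_int (2 * j) (int j - k)) / 4 ^ j"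
  have "((\<lambda>x. cos (of_int (2 * k) * x) * sin x ^ (2 * j) / 2
        - cos (of_int (2 * (k + 1)) * x) * sin x ^ (2 * j) / 4
        - cos (of_int (2 * (k - 1)) * x) * sin x ^ (2 * j) / 4) has_integral
      ?I k / 2 - ?I (k + 1) / 4 - ?I (k - 1) / 4) {0..2 * pi}"
    by (intro has_integral_diff has_integral_divide Suc)
  moreover have "cos (of_int (2 * k) * x) * sin x ^ (2 * j) / 2
        - cos (of_int (2 * (k + 1)) * x) * sin x ^ (2 * j) / 4
        - cos (of_int (2 * (k - 1)) * x) * sin x ^ (2 * j) / 4
      = cos (of_int (2 * k) * x) * sin x ^ (2 * Suc j)" for x :: real
  proof -
    have "cos (of_int (2 * k) * x) * sin x ^ (2 * Suc j)
        = (cos (of_int (2 * k) * x) * (sin x)\<^sup>2) * sin x ^ (2 * j)"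
      by (simp add: power2_eq_square mult_ac)
    then show ?thesis
      unfolding cos_mult_sin_squared by (simp add: left_diff_distrib)
  qed
  \<comment> \<open>The factor \<open>(-1) powi k\<close> changes sign at both neighbours, so the
    weights 1/2, -1/4, -1/4 become 1/4 times 2, 1, 1: Pascal's rule applied twice.\<close>
  moreover have "?I k / 2 - ?I (k + 1) / 4 - ?I (k - 1) / 4
      = 2 * pi * (-1) powi k * real (binom_int (2 * Suc j) (int (Suc j) - k)) / 4 ^ Suc j"
  proof -
    have "binom_int (2 * Suc j) (int (Suc j) - k) = binom_int (2 * j) (int j - (k - 1))
        + 2 * binom_int (2 * j) (int j - k) + binom_int (2 * j) (int j - (k + 1))"
      using binom_int_Suc_Suc[of "2 * j" "int (Suc j) - k"] by (simp add: algebra_simps)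
    then show ?thesis
      by (simp add: power_int_add power_int_diff field_simps)
  qed
  ultimately show ?case
    by simp
qed

text \<open>Consecutive coefficients have ratio \<open>- q\<close> with 0 < \<open>q\<close> < 1, so
  from 1/2 on the signs alternate and the absolute values decrease.\<close>

lemma alternating_half_gchoose: "(-1) ^ j * ((1/2 :: real) gchoose Suc j) \<in> {0<..1/2}"
proof (induction j)
  case 0
  show ?case by simp
next
  case (Suc j)
  define q where "q = (real j + 1/2) / (real j + 2)"
  have q: "0 < q" "q \<le> 1"
    by (simp_all add: q_def)
  have "real (Suc (Suc j)) * ((1/2 :: real) gchoose Suc (Suc j))
      = (1/2 - real (Suc j)) * ((1/2) gchoose Suc j)"
    by (simp only: gbinomial_absorption gbinomial_absorb_comp)
  then have "(1/2 :: real) gchoose Suc (Suc j) = - q * ((1/2) gchoose Suc j)"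
    by (simp add: q_def field_simps)
  then have eq: "(-1) ^ Suc j * ((1/2 :: real) gchoose Suc (Suc j))
      = q * ((-1) ^ j * ((1/2) gchoose Suc j))"
    by simp
  show ?case
    using Suc q mult_mono[of q 1 "(-1) ^ j * ((1/2) gchoose Suc j)" "1/2"]
    unfolding eq by simp
qed

lemma abs_half_gchoose:
  assumes "j \<ge> 1"
  shows "\<bar>(1/2 :: real) gchoose j\<bar> = - ((-1) ^ j * ((1/2) gchoose j))"
    and "0 < \<bar>(1/2 :: real) gchoose j\<bar>" and "\<bar>(1/2 :: real) gchoose j\<bar> \<le> 1/2"
proof -
  obtain i where j: "j = Suc i"
    using assms by (cases j) auto
  have "\<bar>(1/2 :: real) gchoose j\<bar> = \<bar>(-1) ^ i * ((1/2) gchoose Suc i)\<bar>"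
    by (simp add: abs_mult power_abs j)
  also have "\<dots> = (-1) ^ i * ((1/2) gchoose Suc i)"
    using alternating_half_gchoose[of i] by simp
  finally show "\<bar>(1/2 :: real) gchoose j\<bar> = - ((-1) ^ j * ((1/2) gchoose j))"
    and "0 < \<bar>(1/2 :: real) gchoose j\<bar>" and "\<bar>(1/2 :: real) gchoose j\<bar> \<le> 1/2"
    using alternating_half_gchoose[of i] by (simp_all add: j)
qed

text \<open>The integrand is the mean of the cases \<open>k\<close> and \<open>k + 1\<close> of the
  Fourier integral. Their opposite signs produce the difference of adjacent binomials; the sign of
  the generalized binomial turns \<open>(-1) ^ k\<close> into \<open>(-1) ^ (k + 1)\<close>.\<close>

lemma c_coeff_odd:
  assumes "j \<ge> 1"
  shows "c_coeff j (2 * k + 1) = (-1) ^ (k + 1) * (pi / 4 ^ j) * \<bar>(1/2 :: real) gchoose j\<bar> *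
    (real (binom_int (2 * j) (int j - int k)) - real (binom_int (2 * j) (int j - int k - 1)))"
proof -
  let ?I = "\<lambda>k. 2 * pi * (-1) powi k * real (binom_int (2 * j) (int j - k)) / 4 ^ j"
  have "cos x * cos (real (2 * k + 1) * x) * sin x ^ (2 * j)
      = (cos (of_int (2 * int k) * x) * sin x ^ (2 * j)
         + cos (of_int (2 * (int k + 1)) * x) * sin x ^ (2 * j)) / 2" for x :: real
  proof -
    have "of_int (2 * int k) * x = real (2 * k + 1) * x - x"
      "of_int (2 * (int k + 1)) * x = real (2 * k + 1) * x + x"
      by (simp_all add: algebra_simps)
    then show ?thesis
      by (simp only: cos_add cos_diff) (simp add: field_simps)
  qed
  moreover have "((\<lambda>x. (cos (of_int (2 * int k) * x) * sin x ^ (2 * j)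
         + cos (of_int (2 * (int k + 1)) * x) * sin x ^ (2 * j)) / 2) has_integral
      (?I (int k) + ?I (int k + 1)) / 2) {0..2 * pi}"
    by (intro has_integral_divide has_integral_add has_integral_cos_mult_sin_power)
  ultimately have int: "integral {0..2 * pi}
      (\<lambda>x. cos x * cos (real (2 * k + 1) * x) * sin x ^ (2 * j)) = (?I (int k) + ?I (int k + 1)) / 2"
    by (simp only: integral_unique)
  have g: "(-1) ^ j * ((1/2 :: real) gchoose j) = - \<bar>(1/2 :: real) gchoose j\<bar>"
    using abs_half_gchoose(1)[OF assms] by simp
  show ?thesis
    unfolding c_coeff_def int g by (simp add: power_int_add field_simps)
qed

lemma c_coeff_odd_eq_0:
  assumes "j \<ge> 1" and "j < k"
  shows "c_coeff j (2 * k + 1) = 0"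
  unfolding c_coeff_odd[OF assms(1)] using assms(2) by (simp add: binom_int_def)

lemma c_coeff_odd_lowest:
  assumes "k \<ge> 1"
  shows "c_coeff k (2 * k + 1) = (-1) ^ (k + 1) * (pi / 4 ^ k) * \<bar>(1/2 :: real) gchoose k\<bar>"
  unfolding c_coeff_odd[OF assms] by (simp add: binom_int_def)

text \<open>Both lower entries are at most \<open>j\<close>, the middle of row \<open>2 * j\<close>,
  where the row is still increasing; so the bracket is nonnegative.\<close>

lemma sgn_c_coeff_odd:
  assumes "j \<ge> 1" and "c_coeff j (2 * k + 1) \<noteq> 0"
  shows "sgn (c_coeff j (2 * k + 1)) = (-1) ^ (k + 1)"
proof -
  define p where "p = pi / 4 ^ j * \<bar>(1/2 :: real) gchoose j\<bar> *
    (real (binom_int (2 * j) (int j - int k)) - real (binom_int (2 * j) (int j - int k - 1)))"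
  have "p \<ge> 0"
    unfolding p_def by (simp add: binom_int_mono)
  moreover have c: "c_coeff j (2 * k + 1) = (-1) ^ (k + 1) * p"
    unfolding c_coeff_odd[OF assms(1)] by (simp add: p_def)
  ultimately have "p > 0"
    using assms(2) by (cases "p = 0") simp_all
  then show ?thesis
    unfolding c by (cases "even k") simp_all
qed

lemma abs_c_coeff_odd_le:
  assumes "j \<ge> 1" and "k \<ge> 1"
  shows "\<bar>c_coeff j (2 * k + 1)\<bar> \<le> pi / 8"
proof -
  define b where "b = binom_int (2 * j) (int j - int k)"
  define b' where "b' = binom_int (2 * j) (int j - int k - 1)"
  have "b' \<le> b"
    unfolding b_def b'_def by (simp add: binom_int_mono)
  \<comment> \<open>As \<open>k \<ge> 1\<close>, the lower entry lies strictly left of the middle;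
    if it is negative, then \<open>b = 0\<close>.\<close>
  moreover have "4 * b \<le> 4 ^ j"
    using binomial_quarter_bound[of "nat (int j - int k)" "2 * j"] assms
    by (auto simp: b_def binom_int_def power_mult)
  ultimately have "\<bar>real b - real b'\<bar> \<le> 4 ^ j / 4"
    using of_nat_mono[of "4 * b" "4 ^ j", where 'a = real] by simp
  then have "\<bar>(1/2 :: real) gchoose j\<bar> * \<bar>real b - real b'\<bar> \<le> 1/2 * (4 ^ j / 4)"
    using abs_half_gchoose(3)[OF assms(1)] by (intro mult_mono) simp_all
  then have "(pi / 4 ^ j) * (\<bar>(1/2 :: real) gchoose j\<bar> * \<bar>real b - real b'\<bar>)
      \<le> (pi / 4 ^ j) * (1/2 * (4 ^ j / 4))"
    by (intro mult_left_mono) simp_all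
  moreover have "\<bar>c_coeff j (2 * k + 1)\<bar>
      = (pi / 4 ^ j) * (\<bar>(1/2 :: real) gchoose j\<bar> * \<bar>real b - real b'\<bar>)"
    using c_coeff_odd[OF assms(1), of k] by (simp add: b_def b'_def abs_mult power_abs)
  ultimately show ?thesis
    by simp
qed

theorem proposition1p3:
  fixes n m :: nat
  assumes "n > 1" and "odd n" and "m > 0" and "odd m" and "n dvd m"
  shows
    "(\<forall>j\<ge>1. c_coeff j m =
        (-1) ^ ((m + 1) div 2) * (pi / 2 ^ (2 * j)) * \<bar>(1/2 :: real) gchoose j\<bar> *
        (real (binom_int (2 * j) ((2 * int j - int m + 1) div 2))
          - real (binom_int (2 * j) ((2 * int j - int m - 1) div 2))))
     \<and> (\<forall>j\<ge>1. c_coeff j m \<noteq> 0 \<longrightarrow> sgn (c_coeff j m) = (-1) ^ ((m + 1) div 2))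
     \<and> (P_series m \<noteq> 0 \<and> subdegree (P_series m) = m - 1
        \<and> fps_nth (P_series m) (m - 1) = c_coeff ((m - 1) div 2) m
        \<and> c_coeff ((m - 1) div 2) m =
            (-1) ^ ((m + 1) div 2) * (pi / 2 ^ (m - 1)) * \<bar>(1/2 :: real) gchoose ((m - 1) div 2)\<bar>)
     \<and> ((\<forall>j\<ge>1. \<bar>c_coeff j m\<bar> \<le> \<bar>c_coeff 1 3\<bar>) \<and> \<bar>c_coeff 1 3\<bar> = pi / 8)"
proof -
  from \<open>odd m\<close> obtain k where m: "m = 2 * k + 1"
    by (auto elim: oddE)
  \<comment> \<open>A positive multiple of \<open>n\<close> is at least \<open>n\<close>. This gives
    \<open>k \<ge> 1\<close>, which the leading term and the bound require.\<close>
  have "m > 1"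
    using assms dvd_imp_le[of n m] by simp
  then have k: "k \<ge> 1"
    by (simp add: m)
  \<comment> \<open>All numerators are even, so \<open>div\<close> is exact, also on negative
    integers.\<close>
  have div: "(m + 1) div 2 = k + 1" "(m - 1) div 2 = k"
    "(2 * int j - int m + 1) div 2 = int j - int k"
    "(2 * int j - int m - 1) div 2 = int j - int k - 1" for j
    unfolding m by linarith+
  have pow: "(2::real) ^ (2 * j) = 4 ^ j" "(2::real) ^ (m - 1) = 4 ^ k" for j
    by (simp_all add: power_mult m)
  have nth: "fps_nth (P_series m) (m - 1) = c_coeff k m"
    using k by (simp add: P_series_def m)
  have lead: "c_coeff k m \<noteq> 0"
    using abs_half_gchoose(2)[OF k] c_coeff_odd_lowest[OF k] by (simp add: m)
  have "subdegree (P_series m) = m - 1"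
  proof (rule subdegreeI)
    show "fps_nth (P_series m) (m - 1) \<noteq> 0"
      using nth lead by simp
    show "fps_nth (P_series m) i = 0" if "i < m - 1" for i
      \<comment> \<open>Odd \<open>i\<close> and \<open>i = 0\<close> vanish by definition of
        \<open>P_series\<close>; for other \<open>i\<close> the index \<open>i div 2\<close> is
        below \<open>k\<close>.\<close>
      using that c_coeff_odd_eq_0[of "i div 2" k] by (auto simp: P_series_def m)
  qed
  moreover have "P_series m \<noteq> 0"
    using nth lead by auto
  \<comment> \<open>This is the lowest coefficient for \<open>k = 1\<close>, namely (\<pi>/4)(1/2),
    so the bound is attained.\<close>
  moreover have "c_coeff 1 3 = pi / 8"
    using c_coeff_odd_lowest[of 1] by (simp add: numeral_3_eq_3)
  then have "\<bar>c_coeff 1 3\<bar> = pi / 8"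
    by (simp only:) simp
  ultimately show ?thesis
    using c_coeff_odd[of _ k, folded m] sgn_c_coeff_odd[of _ k, folded m]
      abs_c_coeff_odd_le[OF _ k, folded m] nth c_coeff_odd_lowest[OF k, folded m]
    unfolding div pow by presburger
qed

end
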